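(* Let $a=(a_i)_{i\in\mathbb Z}$ be an arbitrary sequence of complex numbers. For every Young diagram $\mu$ with transposed diagram $\mu'$, $$s_{\mu;a}=\det[e_{\mu'_i-i+j;\,\tau^{j-1}a}],$$ where the order of the determinant is any number $\ge\ell(\mu')$, $e_{k;a}=s_{(1^k);a}$ for $k\ge1$, $e_{0;a}=1$, and $e_{-1;a}=e_{-2;a}=\dots=0$.
   Context: The base field is $\mathbb C$. $\Lambda=\mathbb C[\mathbf p_1,\mathbf p_2,\dots]$ is the algebra of symmetric functions (polynomial ring in the power sums). Its elements $h_k$ are defined by $H(u)=1+\sum_{k\ge1}h_ku^{-k}=\exp\big(\sum_{k\ge1}\mathbf p_ku^{-k}/k\big)\in\Lambda[[u^{-1}]]$. The elements $h_{k;a}\in\Lambda$ are defined by $1+\sum_{k\ge1}\frac{h_{k;a}}{(u-a_1)\cdots(u-a_k)}=H(u)$ in $\Lambda[[u^{-1}]]$, with $h_{0;a}=1$, $h_{k;a}=0$ for $k<0$. For $r\in\mathbb Z$, $(\tau^ra)_i=a_{i+r}$. The multiparameter Schur function is $s_{\mu;a}=\det[h_{\mu_i-i+j;\,\tau^{1-j}a}]$ (order any number $\ge\ell(\mu)$, where $\ell$ is the number of nonzero rows). *)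

theory Defs
  imports
    "HOL-Library.Poly_Mapping"
    "HOL-Computational_Algebra.Formal_Power_Series"
    "Jordan_Normal_Form.Determinant"
    Complex_Main
begin

no_notation vec_index (infixl "$" 100)
unbundle fps_syntax

text \<open>A monomial is a finitely supported exponent function. To get exactly the variables
  \<open>p\<^sub>1, p\<^sub>2, \<dots>\<close>, the exponent of \<open>p\<^sub>k\<close> is stored at position \<open>k - 1\<close>.\<close>

type_synonym symfun = "(nat \<Rightarrow>\<^sub>0 nat) \<Rightarrow>\<^sub>0 complex"

definition scalar :: "complex \<Rightarrow> symfun" where
  "scalar c = Poly_Mapping.single 0 c"

definition power_sum :: "nat \<Rightarrow> symfun" where
  "power_sum k = Poly_Mapping.single (Poly_Mapping.single (k - 1) 1) 1"

text \<open>Formal power series over \<^typ>\<open>symfun\<close> are series in \<open>u\<inverse>\<close>: \<^const>\<open>fps_X\<close> stands for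
  \<open>u\<inverse>\<close>. The library's \<^const>\<open>fps_exp\<close> needs coefficients in a field, so the exponential of a
  series \<open>F\<close> with zero constant term is written as the composition of \<open>\<Sum> X\<^sup>n / n!\<close> with \<open>F\<close>.\<close>

definition formal_exp :: "symfun fps \<Rightarrow> symfun fps" where
  "formal_exp F = Abs_fps (\<lambda>n. scalar (1 / fact n)) oo F"

definition H_series :: "symfun fps" where
  "H_series = formal_exp (Abs_fps (\<lambda>k. if k = 0 then 0 else scalar (1 / of_nat k) * power_sum k))"

definition tau :: "int \<Rightarrow> (int \<Rightarrow> complex) \<Rightarrow> int \<Rightarrow> complex" where
  "tau r a = (\<lambda>i. a (i + r))"

text \<open>The expansion of \<open>1 / ((u - a\<^sub>1) \<cdots> (u - a\<^sub>k))\<close> in powers of \<open>u\<inverse>\<close>, that is,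
  \<open>u\<^sup>-\<^sup>k / ((1 - a\<^sub>1 u\<inverse>) \<cdots> (1 - a\<^sub>k u\<inverse>))\<close>. The coefficient ring is not a field, hence
  \<^const>\<open>fps_right_inverse_constructor\<close> instead of \<^const>\<open>inverse\<close>.\<close>

definition shifted_denom :: "(int \<Rightarrow> complex) \<Rightarrow> nat \<Rightarrow> symfun fps" where
  "shifted_denom a k = (\<Prod>i = 1..k. 1 - fps_const (scalar (a (int i))) * fps_X)"

definition inv_shifted_power :: "(int \<Rightarrow> complex) \<Rightarrow> nat \<Rightarrow> symfun fps" where
  "inv_shifted_power a k = fps_X ^ k * fps_right_inverse (shifted_denom a k) 1"

definition is_complete_seq :: "(int \<Rightarrow> complex) \<Rightarrow> (nat \<Rightarrow> symfun) \<Rightarrow> bool" where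
  "is_complete_seq a h \<longleftrightarrow>
     h 0 = 1 \<and> (\<lambda>k. fps_const (h k) * inv_shifted_power a k) sums H_series"

definition complete_seq :: "(int \<Rightarrow> complex) \<Rightarrow> nat \<Rightarrow> symfun" where
  "complete_seq a = (THE h. is_complete_seq a h)"

definition mp_complete :: "int \<Rightarrow> (int \<Rightarrow> complex) \<Rightarrow> symfun" where
  "mp_complete k a = (if k < 0 then 0 else complete_seq a (nat k))"

text \<open>A diagram is given by its row lengths \<open>\<mu> 1 \<ge> \<mu> 2 \<ge> \<dots>\<close>; the value \<open>\<mu> 0\<close> is irrelevant.\<close>

definition young_diagram :: "(nat \<Rightarrow> nat) \<Rightarrow> bool" where
  "young_diagram \<mu> \<longleftrightarrow> (\<forall>i\<ge>1. \<mu> (Suc i) \<le> \<mu> i) \<and> finite {i. 1 \<le> i \<and> \<mu> i \<noteq> 0}"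

definition num_rows :: "(nat \<Rightarrow> nat) \<Rightarrow> nat" where
  "num_rows \<mu> = card {i. 1 \<le> i \<and> \<mu> i \<noteq> 0}"

definition transposed :: "(nat \<Rightarrow> nat) \<Rightarrow> nat \<Rightarrow> nat" where
  "transposed \<mu> j = card {i. 1 \<le> i \<and> 1 \<le> j \<and> j \<le> \<mu> i}"

definition column :: "nat \<Rightarrow> nat \<Rightarrow> nat" where
  "column k i = (if 1 \<le> i \<and> i \<le> k then 1 else 0)"

text \<open>Matrices of \<^theory>\<open>Jordan_Normal_Form.Matrix\<close> are indexed from 0, determinants below
  from 1.\<close>

definition det_order :: "nat \<Rightarrow> (nat \<Rightarrow> nat \<Rightarrow> symfun) \<Rightarrow> symfun" where
  "det_order n f = det (mat n n (\<lambda>(i, j). f (Suc i) (Suc j)))"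

definition jacobi_trudi :: "nat \<Rightarrow> (nat \<Rightarrow> nat) \<Rightarrow> (int \<Rightarrow> complex) \<Rightarrow> symfun" where
  "jacobi_trudi n \<mu> a =
     det_order n (\<lambda>i j. mp_complete (int (\<mu> i) - int i + int j) (tau (1 - int j) a))"

text \<open>Any order \<open>n \<ge> num_rows \<mu>\<close> gives the same value; see \<open>mp_schur_eq_jacobi_trudi\<close> below.\<close>

definition mp_schur :: "(nat \<Rightarrow> nat) \<Rightarrow> (int \<Rightarrow> complex) \<Rightarrow> symfun" where
  "mp_schur \<mu> a = jacobi_trudi (num_rows \<mu>) \<mu> a"

definition mp_elementary :: "int \<Rightarrow> (int \<Rightarrow> complex) \<Rightarrow> symfun" where
  "mp_elementary k a =
     (if k < 0 then 0 else if k = 0 then 1 else mp_schur (column (nat k)) a)"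

lemma shifted_denom_nth_0: "shifted_denom a k $ 0 = 1"
proof -
  have "(\<Prod>i\<in>A. 1 - fps_const (scalar (a (int i))) * fps_X) $ 0 = 1" if "finite A" for A
    using that by (induction A rule: finite_induct) simp_all
  then show ?thesis
    unfolding shifted_denom_def by blast
qed

lemma inv_shifted_power_mult: "inv_shifted_power a k * shifted_denom a k = fps_X ^ k"
proof -
  have "shifted_denom a k * fps_right_inverse (shifted_denom a k) 1 = 1"
    by (rule fps_right_inverse) (simp add: shifted_denom_nth_0)
  then have "fps_X ^ k * (shifted_denom a k * fps_right_inverse (shifted_denom a k) 1) = fps_X ^ k"
    by (simp only: mult_1_right)
  then show ?thesis
    unfolding inv_shifted_power_def by (simp only: mult.assoc mult.commute mult.left_commute)
qed

lemma inv_shifted_power_nth_less: "n < k \<Longrightarrow> inv_shifted_power a k $ n = 0"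
  unfolding inv_shifted_power_def by (simp add: fps_X_power_mult_nth)

lemma inv_shifted_power_nth_self: "inv_shifted_power a k $ k = 1"
  unfolding inv_shifted_power_def by (simp add: fps_X_power_mult_nth)

lemma H_series_nth_0: "H_series $ 0 = 1"
  unfolding H_series_def formal_exp_def by (simp add: fps_compose_nth scalar_def)

lemma sums_triangular_iff:
  fixes h :: "nat \<Rightarrow> symfun"
  shows "(\<lambda>k. fps_const (h k) * inv_shifted_power a k) sums F \<longleftrightarrow>
    (\<forall>n. F $ n = h n + (\<Sum>k<n. h k * inv_shifted_power a k $ n))"
proof -
  have part: "(\<Sum>k<N. fps_const (h k) * inv_shifted_power a k) $ n =
      h n + (\<Sum>k<n. h k * inv_shifted_power a k $ n)" if "n < N" for N n
  proof -
    have "(\<Sum>k<N. fps_const (h k) * inv_shifted_power a k) $ n =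
        (\<Sum>k<N. h k * inv_shifted_power a k $ n)"
      by (simp add: fps_sum_nth)
    also have "\<dots> = (\<Sum>k<Suc n. h k * inv_shifted_power a k $ n)"
      by (rule sum.mono_neutral_right) (use that in \<open>auto simp: inv_shifted_power_nth_less\<close>)
    also have "\<dots> = h n + (\<Sum>k<n. h k * inv_shifted_power a k $ n)"
      by (simp add: inv_shifted_power_nth_self add.commute)
    finally show ?thesis .
  qed
  have ev: "eventually (\<lambda>N. (\<Sum>k<N. fps_const (h k) * inv_shifted_power a k) $ n = F $ n)
      sequentially \<longleftrightarrow> F $ n = h n + (\<Sum>k<n. h k * inv_shifted_power a k $ n)" for n
  proof
    assume "eventually (\<lambda>N. (\<Sum>k<N. fps_const (h k) * inv_shifted_power a k) $ n = F $ n)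
      sequentially"
    with eventually_gt_at_top[of n]
    have "eventually (\<lambda>N. F $ n = h n + (\<Sum>k<n. h k * inv_shifted_power a k $ n)) sequentially"
    proof eventually_elim
      case (elim N)
      then show ?case using part[of n N] by simp
    qed
    then show "F $ n = h n + (\<Sum>k<n. h k * inv_shifted_power a k $ n)"
      by simp
  next
    assume F: "F $ n = h n + (\<Sum>k<n. h k * inv_shifted_power a k $ n)"
    show "eventually (\<lambda>N. (\<Sum>k<N. fps_const (h k) * inv_shifted_power a k) $ n = F $ n)
      sequentially"
      using eventually_gt_at_top[of n] by eventually_elim (simp only: part F)
  qed
  show ?thesis
    unfolding sums_def tendsto_fps_iff ev ..
qed

fun triangular_solution :: "(int \<Rightarrow> complex) \<Rightarrow> nat \<Rightarrow> symfun" where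
  "triangular_solution a n =
     H_series $ n - (\<Sum>k<n. triangular_solution a k * inv_shifted_power a k $ n)"

declare triangular_solution.simps [simp del]

lemma ex1_complete_seq: "\<exists>!h. is_complete_seq a h"
proof (rule ex1I[of _ "triangular_solution a"])
  have "triangular_solution a 0 = 1"
    by (subst triangular_solution.simps) (simp add: H_series_nth_0)
  moreover have "H_series $ n = triangular_solution a n +
      (\<Sum>k<n. triangular_solution a k * inv_shifted_power a k $ n)" for n
    by (subst triangular_solution.simps) simp
  ultimately show "is_complete_seq a (triangular_solution a)"
    unfolding is_complete_seq_def sums_triangular_iff by blast
next
  fix h assume h: "is_complete_seq a h"
  have "h n = triangular_solution a n" for n
  proof (induction n rule: less_induct)
    case (less n)
    have "H_series $ n = h n + (\<Sum>k<n. h k * inv_shifted_power a k $ n)"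
      using h unfolding is_complete_seq_def sums_triangular_iff by blast
    also have "(\<Sum>k<n. h k * inv_shifted_power a k $ n) =
        (\<Sum>k<n. triangular_solution a k * inv_shifted_power a k $ n)"
      by (rule sum.cong) (simp_all add: less)
    finally show ?case
      by (subst triangular_solution.simps) simp
  qed
  then show "h = triangular_solution a" by blast
qed

lemma is_complete_seq_complete_seq: "is_complete_seq a (complete_seq a)"
  unfolding complete_seq_def by (rule theI'[OF ex1_complete_seq])

lemma mp_complete_0: "mp_complete 0 a = 1"
  using is_complete_seq_complete_seq[of a] by (simp add: mp_complete_def is_complete_seq_def)

lemma young_diagram_zero:
  assumes "young_diagram \<mu>" "num_rows \<mu> < i"
  shows "\<mu> i = 0"
proof (rule ccontr)
  assume nz: "\<mu> i \<noteq> 0"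
  have "\<mu> i \<le> \<mu> j" if "1 \<le> j" "j \<le> i" for j
    using \<open>j \<le> i\<close>
  proof (induction i rule: dec_induct)
    case (step m)
    then have "\<mu> (Suc m) \<le> \<mu> m"
      using assms(1) \<open>1 \<le> j\<close> unfolding young_diagram_def by simp
    with step show ?case by simp
  qed simp
  then have "0 < \<mu> j" if "1 \<le> j" "j \<le> i" for j
    using that nz by (metis gr0I le_zero_eq)
  then have "{1..i} \<subseteq> {j. 1 \<le> j \<and> \<mu> j \<noteq> 0}"
    by auto
  then have "card {1..i} \<le> num_rows \<mu>"
    using assms(1) unfolding num_rows_def young_diagram_def by (intro card_mono) auto
  with assms(2) show False by simp
qed

lemma jacobi_trudi_Suc:
  assumes "\<mu> (Suc n) = 0"
  shows "jacobi_trudi (Suc n) \<mu> a = jacobi_trudi n \<mu> a"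
proof -
  define f where "f i j = mp_complete (int (\<mu> i) - int i + int j) (tau (1 - int j) a)" for i j
  define A where "A = mat (Suc n) (Suc n) (\<lambda>(i, j). f (Suc i) (Suc j))"
  have A: "A \<in> carrier_mat (Suc n) (Suc n)"
    by (simp add: A_def)
  have row: "A $$ (n, j) = (if j = n then 1 else 0)" if "j < Suc n" for j
  proof (cases "j = n")
    case True
    then show ?thesis by (simp add: A_def f_def assms mp_complete_0)
  next
    case False
    with that have "j < n" by simp
    then show ?thesis by (simp add: A_def f_def assms mp_complete_def)
  qed
  have "det A = (\<Sum>j<Suc n. A $$ (n, j) * cofactor A n j)"
    by (rule laplace_expansion_row[OF A]) simp
  also have "\<dots> = (\<Sum>j<Suc n. if j = n then cofactor A n j else 0)"
    by (rule sum.cong) (auto simp: row)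
  also have "\<dots> = cofactor A n n"
    by simp
  also have "\<dots> = det (mat_delete A n n)"
    by (simp add: cofactor_def)
  also have "mat_delete A n n = mat n n (\<lambda>(i, j). f (Suc i) (Suc j))"
    by (rule eq_matI) (auto simp: mat_delete_def A_def)
  finally show ?thesis
    by (simp add: jacobi_trudi_def det_order_def A_def f_def)
qed

lemma mp_schur_eq_jacobi_trudi:
  assumes "young_diagram \<mu>" "num_rows \<mu> \<le> n"
  shows "mp_schur \<mu> a = jacobi_trudi n \<mu> a"
  using assms(2)
proof (induction n rule: dec_induct)
  case base
  show ?case by (simp add: mp_schur_def)
next
  case (step n)
  then have "\<mu> (Suc n) = 0"
    using young_diagram_zero[OF assms(1)] by simp
  with step show ?case by (simp add: jacobi_trudi_Suc)
qed

lemma young_diagram_column: "young_diagram (column k)"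
proof -
  have "{i. 1 \<le> i \<and> column k i \<noteq> 0} \<subseteq> {..k}"
    by (auto simp: column_def split: if_splits)
  then have "finite {i. 1 \<le> i \<and> column k i \<noteq> 0}"
    by (rule finite_subset) simp
  then show ?thesis
    by (simp add: young_diagram_def column_def)
qed

end

theory Submission
  imports Defs
begin

text \<open>The identity is Jacobi's theorem on complementary minors of inverse matrices, applied to one
  infinite matrix. Put \<open>H x y = h\<^bsub>y-x; \<tau>\<^sup>1\<^sup>-\<^sup>y a\<^esub>\<close> for integers \<open>x\<close>, \<open>y\<close>. Since \<open>h\<^sub>0 = 1\<close> and
  \<open>h\<^sub>k = 0\<close> for \<open>k < 0\<close>, this array is upper unitriangular and has an inverse \<open>E\<close> of the same
  shape. The determinant defining \<open>s\<^bsub>\<mu>;a\<^esub>\<close> is the minor of \<open>H\<close> on the rows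
  \<open>i - \<mu>\<^sub>i\<close> and the columns \<open>1, \<dots>, l\<close>.

  Inside the window \<open>1 - m, \<dots>, l\<close>, where \<open>m\<close> bounds the row lengths, the columns left out are
  \<open>1 - j\<close> and the rows left out are \<open>\<mu>'\<^sub>j - j + 1\<close>, for \<open>1 \<le> j \<le> m\<close>: the numbers \<open>i - \<mu>\<^sub>i\<close> and
  \<open>\<mu>'\<^sub>j - j + 1\<close> label the vertical and the horizontal steps of the boundary path of \<open>\<mu>\<close>, and
  together they fill the window. So the minor of \<open>H\<close> equals
  \<open>(-1)\<^bsup>|\<mu>|\<^esup>\<close> times the minor of \<open>E\<close> on rows \<open>1 - i\<close> and columns \<open>\<mu>'\<^sub>j - j + 1\<close>
  (\<open>complementary_minors\<close>; the sign is computed in \<open>det_boundary_matrix\<close>).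

  The same statement for a single column identifies the entries of \<open>E\<close>: there the complementary
  minor has order one, and after a translation of the index set it reads
  \<open>E x y = (-1)\<^bsup>y-x\<^esup> e\<^bsub>y-x; \<tau>\<^sup>-\<^sup>x a\<^esub>\<close> (\<open>mp_elementary_eq_inverse_entry\<close>). Pulling the
  signs out of rows and columns cancels \<open>(-1)\<^bsup>|\<mu>|\<^esup>\<close>.\<close>

section \<open>Determinants under rescaling and reindexing\<close>

lemma det_rescale_rows_columns:
  fixes f :: "nat \<Rightarrow> nat \<Rightarrow> 'a::comm_ring_1"
  shows "det (mat n n (\<lambda>(i, j). c i * d j * f i j)) =
    (\<Prod>i<n. c i) * (\<Prod>j<n. d j) * det (mat n n (\<lambda>(i, j). f i j))"
proof -
  have "signof p * (\<Prod>i = 0..<n. c i * d (p i) * f i (p i)) =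
      (\<Prod>i<n. c i) * (\<Prod>j<n. d j) * (signof p * (\<Prod>i = 0..<n. f i (p i)))"
    if p: "p permutes {0..<n}" for p
  proof -
    have "(\<Prod>i = 0..<n. d (p i)) = (\<Prod>i = 0..<n. d i)"
      using prod.permute[OF p, of d] by (simp add: comp_def)
    then show ?thesis
      by (simp add: prod.distrib lessThan_atLeast0 mult_ac)
  qed
  moreover have "(\<Prod>i = 0..<n. mat n n (\<lambda>(i, j). g i j) $$ (i, p i)) = (\<Prod>i = 0..<n. g i (p i))"
    if "p permutes {0..<n}" for p and g :: "nat \<Rightarrow> nat \<Rightarrow> 'a"
  proof (rule prod.cong)
    fix i assume "i \<in> {0..<n}"
    with permutes_in_image[OF that, of i]
    show "mat n n (\<lambda>(i, j). g i j) $$ (i, p i) = g i (p i)" by simp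
  qed simp
  ultimately show ?thesis
    by (simp add: det_def'[of _ n] sum_distrib_left)
qed

lemma det_transpose_entries:
  "det (mat n n (\<lambda>(i, j). f i j)) = det (mat n n (\<lambda>(i, j). f j i))"
proof -
  have "(mat n n (\<lambda>(i, j). f i j))\<^sup>T = mat n n (\<lambda>(i, j). f j i)"
    by (rule eq_matI) auto
  then show ?thesis
    using det_transpose[of "mat n n (\<lambda>(i, j). f i j)" n] by simp
qed

lemma det_simultaneous_permutation:
  fixes f :: "nat \<Rightarrow> nat \<Rightarrow> 'a::comm_ring_1"
  assumes p: "p permutes {0..<n}"
  shows "det (mat n n (\<lambda>(i, j). f (p i) (p j))) = det (mat n n (\<lambda>(i, j). f i j))"
proof -
  have rows: "det (mat n n (\<lambda>(i, j). g (p i) j)) = signof p * det (mat n n (\<lambda>(i, j). g i j))"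
    for g :: "nat \<Rightarrow> nat \<Rightarrow> 'a"
  proof -
    have "mat n n (\<lambda>(i, j). g (p i) j) =
        mat n n (\<lambda>(i, j). mat n n (\<lambda>(i, j). g i j) $$ (p i, j))"
      by (rule eq_matI) (use permutes_in_image[OF p] in auto)
    then show ?thesis
      using det_permute_rows[of "mat n n (\<lambda>(i, j). g i j)" n p] p by simp
  qed
  have "det (mat n n (\<lambda>(i, j). f (p i) (p j))) = signof p * det (mat n n (\<lambda>(i, j). f i (p j)))"
    by (rule rows)
  also have "det (mat n n (\<lambda>(i, j). f i (p j))) = det (mat n n (\<lambda>(i, j). f j (p i)))"
    by (rule det_transpose_entries)
  also have "\<dots> = signof p * det (mat n n (\<lambda>(i, j). f j i))"
    by (rule rows)
  also have "det (mat n n (\<lambda>(i, j). f j i)) = det (mat n n (\<lambda>(i, j). f i j))"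
    by (rule det_transpose_entries)
  also have "signof p * (signof p * det (mat n n (\<lambda>(i, j). f i j))) =
      det (mat n n (\<lambda>(i, j). f i j))"
    by (simp add: sign_def)
  finally show ?thesis .
qed

lemma det_reverse_rows_columns:
  fixes f :: "nat \<Rightarrow> nat \<Rightarrow> 'a::comm_ring_1"
  shows "det (mat n n (\<lambda>(i, j). f (n - Suc i) (n - Suc j))) = det (mat n n (\<lambda>(i, j). f i j))"
proof -
  define p where "p i = (if i < n then n - Suc i else i)" for i
  have p: "p permutes {0..<n}"
  proof (rule bij_imp_permutes)
    show "bij_betw p {0..<n} {0..<n}"
      by (rule bij_betw_byWitness[where f' = p]) (auto simp: p_def)
  qed (simp add: p_def)
  have "mat n n (\<lambda>(i, j). f (n - Suc i) (n - Suc j)) = mat n n (\<lambda>(i, j). f (p i) (p j))"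
    by (rule eq_matI) (simp_all add: p_def)
  with det_simultaneous_permutation[OF p, of f] show ?thesis by simp
qed

section \<open>The permutation read off the boundary of a diagram\<close>

text \<open>Positions \<open>0, \<dots>, m + l - 1\<close> stand for the integers \<open>1 - m, \<dots>, l\<close>. An index
  \<open>s < m\<close> stands for the column \<open>j = m - s\<close> of the diagram and is sent to the position of
  \<open>\<mu>'\<^sub>j - j + 1\<close>; an index \<open>s \<ge> m\<close> stands for the row \<open>i = s - m + 1\<close> and is sent to the position
  of \<open>i - \<mu>\<^sub>i\<close>. For the empty diagram this is the identity. Only the first \<open>l\<close> rows of \<open>\<mu>\<close> are seen,
  so that \<open>l\<close> can serve as an induction variable.\<close>

definition boundary_position :: "nat \<Rightarrow> nat \<Rightarrow> (nat \<Rightarrow> nat) \<Rightarrow> nat \<Rightarrow> nat" where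
  "boundary_position l m \<mu> s =
     (if s < m then s + card {i \<in> {1..l}. m - s \<le> \<mu> i} else s - \<mu> (Suc (s - m)))"

definition boundary_matrix :: "nat \<Rightarrow> nat \<Rightarrow> (nat \<Rightarrow> nat) \<Rightarrow> 'a::comm_ring_1 mat" where
  "boundary_matrix l m \<mu> =
     mat (m + l) (m + l) (\<lambda>(s, q). if q = boundary_position l m \<mu> s then 1 else 0)"

lemma card_rows_le: "card {i \<in> {1..l}. Q i} \<le> l"
proof -
  have "card {i \<in> {1..l}. Q i} \<le> card {1..l}"
    by (rule card_mono) auto
  then show ?thesis by simp
qed

lemma boundary_position_less:
  assumes "s < m + l" shows "boundary_position l m \<mu> s < m + l"
  using assms card_rows_le[of l "\<lambda>i. m - s \<le> \<mu> i"] by (auto simp: boundary_position_def)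

text \<open>A new last row of length \<open>\<mu>\<^sub>l\<^sub>+\<^sub>1\<close> takes the position \<open>m + l - \<mu>\<^sub>l\<^sub>+\<^sub>1\<close>. Older rows lie below
  that position because they are at least as long, and so do the columns that it
  does not meet. The columns that it meets lie at that position or above and move up by one,
  because their lengths grow by one.\<close>

lemma boundary_position_Suc:
  assumes anti: "\<And>i. 1 \<le> i \<Longrightarrow> i \<le> l \<Longrightarrow> \<mu> (Suc l) \<le> \<mu> i"
    and le: "\<mu> (Suc l) \<le> m" and s: "s < m + l"
  shows "boundary_position (Suc l) m \<mu> s =
    (if boundary_position l m \<mu> s < m + l - \<mu> (Suc l) then boundary_position l m \<mu> s
     else Suc (boundary_position l m \<mu> s))"
proof (cases "s < m")
  case False
  define i where "i = Suc (s - m)"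
  have "1 \<le> i" "i \<le> l" using False s by (auto simp: i_def)
  then have "\<mu> (Suc l) \<le> \<mu> i" by (rule anti)
  moreover have "s = m + i - 1" using False by (auto simp: i_def)
  ultimately show ?thesis
    using False le s \<open>1 \<le> i\<close> \<open>i \<le> l\<close> unfolding boundary_position_def i_def[symmetric] by auto
next
  case True
  have ins: "{i \<in> {1..Suc l}. m - s \<le> \<mu> i} =
      (if m - s \<le> \<mu> (Suc l) then insert (Suc l) {i \<in> {1..l}. m - s \<le> \<mu> i}
       else {i \<in> {1..l}. m - s \<le> \<mu> i})"
    by (auto simp: le_Suc_eq)
  show ?thesis
  proof (cases "m - s \<le> \<mu> (Suc l)")
    case low: True
    then have "{i \<in> {1..l}. m - s \<le> \<mu> i} = {1..l}"
      using anti by (auto intro: le_trans)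
    with low True ins le show ?thesis
      by (auto simp: boundary_position_def)
  next
    case high: False
    with True ins le card_rows_le[of l "\<lambda>i. m - s \<le> \<mu> i"] show ?thesis
      by (auto simp: boundary_position_def)
  qed
qed

text \<open>Deleting the last row of the permutation matrix, and the column in which its entry sits,
  leaves the matrix of the diagram without its last row. Hence the Laplace expansion contributes
  one factor \<open>(-1)\<^bsup>\<mu>\<^sub>i\<^esup>\<close> for each row.\<close>

lemma det_boundary_matrix:
  assumes "\<And>i j. 1 \<le> i \<Longrightarrow> i \<le> j \<Longrightarrow> j \<le> l \<Longrightarrow> \<mu> j \<le> \<mu> i"
    and "\<And>i. 1 \<le> i \<Longrightarrow> i \<le> l \<Longrightarrow> \<mu> i \<le> m"
  shows "det (boundary_matrix l m \<mu> :: 'a::comm_ring_1 mat) = (- 1) ^ (\<Sum>i = 1..l. \<mu> i)"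
  using assms
proof (induction l)
  case 0
  have "boundary_matrix 0 m \<mu> = (1\<^sub>m m :: 'a mat)"
    unfolding boundary_matrix_def by (rule eq_matI) (auto simp: boundary_position_def)
  then show ?case by simp
next
  case (Suc l)
  let ?P = "boundary_matrix (Suc l) m \<mu> :: 'a mat"
  define q where "q = m + l - \<mu> (Suc l)"
  have le: "\<mu> (Suc l) \<le> m" using Suc.prems(2)[of "Suc l"] by simp
  have anti: "\<mu> (Suc l) \<le> \<mu> i" if "1 \<le> i" "i \<le> l" for i
    using Suc.prems(1)[of i "Suc l"] that by simp
  have "q < Suc (m + l)" by (simp add: q_def)
  have P: "?P \<in> carrier_mat (Suc (m + l)) (Suc (m + l))"
    by (simp add: boundary_matrix_def)
  have last: "boundary_position (Suc l) m \<mu> (m + l) = q"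
    by (simp add: boundary_position_def q_def)
  have "det ?P = (\<Sum>j<Suc (m + l). ?P $$ (m + l, j) * cofactor ?P (m + l) j)"
    by (rule laplace_expansion_row[OF P]) simp
  also have "\<dots> = (\<Sum>j<Suc (m + l). if j = q then cofactor ?P (m + l) j else 0)"
    by (rule sum.cong) (auto simp: boundary_matrix_def last)
  also have "\<dots> = cofactor ?P (m + l) q"
    using \<open>q < Suc (m + l)\<close> by simp
  also have "\<dots> = (- 1) ^ (m + l + q) * det (mat_delete ?P (m + l) q)"
    by (simp add: cofactor_def)
  also have "mat_delete ?P (m + l) q = boundary_matrix l m \<mu>"
  proof (rule eq_matI)
    fix s c assume "s < dim_row (boundary_matrix l m \<mu> :: 'a mat)"
      "c < dim_col (boundary_matrix l m \<mu> :: 'a mat)"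
    then have sc: "s < m + l" "c < m + l" by (simp_all add: boundary_matrix_def)
    have "boundary_position (Suc l) m \<mu> s = (if boundary_position l m \<mu> s < q
        then boundary_position l m \<mu> s else Suc (boundary_position l m \<mu> s))"
      unfolding q_def using anti le sc(1) by (rule boundary_position_Suc)
    with sc
    show "mat_delete ?P (m + l) q $$ (s, c) = boundary_matrix l m \<mu> $$ (s, c)"
      by (auto simp: mat_delete_def boundary_matrix_def)
  qed (simp_all add: mat_delete_def boundary_matrix_def)
  also have "det (boundary_matrix l m \<mu> :: 'a mat) = (- 1) ^ (\<Sum>i = 1..l. \<mu> i)"
    using Suc.prems by (intro Suc.IH) auto
  also have "(- 1 :: 'a) ^ (m + l + q) = (- 1) ^ \<mu> (Suc l)"
    using le by (simp add: minus_one_power_iff q_def)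
  finally show ?case by (simp add: power_add mult.commute)
qed

text \<open>If two indices had the same position, the boundary matrix would have two equal rows, but its
  determinant is a sign. The integers serve as a ring in which signs are nonzero.\<close>

lemma boundary_position_inject:
  assumes "\<And>i j. 1 \<le> i \<Longrightarrow> i \<le> j \<Longrightarrow> j \<le> l \<Longrightarrow> \<mu> j \<le> \<mu> i"
    and "\<And>i. 1 \<le> i \<Longrightarrow> i \<le> l \<Longrightarrow> \<mu> i \<le> m"
    and s: "s < m + l" and t: "t < m + l"
    and eq: "boundary_position l m \<mu> s = boundary_position l m \<mu> t"
  shows "s = t"
proof (rule ccontr)
  let ?P = "boundary_matrix l m \<mu> :: int mat"
  assume "s \<noteq> t"
  moreover have "?P \<in> carrier_mat (m + l) (m + l)"
    by (simp add: boundary_matrix_def)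
  moreover have "row ?P s = row ?P t"
    by (rule eq_vecI) (use s t eq in \<open>simp_all add: boundary_matrix_def\<close>)
  ultimately have "det ?P = 0"
    using s t det_identical_rows by blast
  with det_boundary_matrix[of l \<mu> m, where ?'a = int] assms(1,2) show False
    by simp
qed

section \<open>Complementary minors of inverse unitriangular arrays\<close>

text \<open>Arrays indexed by all pairs of integers avoid a choice of window before the diagram is known;
  by triangularity every entry of the product \<open>H E\<close> is a finite sum.\<close>

locale unitriangular_inverse =
  fixes H E :: "int \<Rightarrow> int \<Rightarrow> 'a::idom"
  assumes H_diag: "H x x = 1"
    and H_below: "y < x \<Longrightarrow> H x y = 0"
    and E_below: "y < x \<Longrightarrow> E x y = 0"
    and H_E: "x \<le> y \<Longrightarrow> (\<Sum>z = x..y. H x z * E z y) = (if x = y then 1 else 0)"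
begin

lemma H_E_window:
  assumes "c \<le> x" "y \<le> d"
  shows "(\<Sum>z = c..d. H x z * E z y) = (if x = y then 1 else 0)"
proof -
  have "(\<Sum>z = c..d. H x z * E z y) = (\<Sum>z = x..y. H x z * E z y)"
    by (rule sum.mono_neutral_right) (use assms in \<open>auto simp: not_le H_below E_below\<close>)
  also have "\<dots> = (if x = y then 1 else 0)"
    by (cases "x \<le> y") (auto simp: H_E)
  finally show ?thesis .
qed

text \<open>Let \<open>P\<close> be the boundary matrix and cut \<open>H\<close> and \<open>E\<close> down to the window. The rows of \<open>P H\<close> and
  the columns of \<open>E P\<^sup>T\<close> are then in the order of the boundary path, and their product is the identity.
  Replacing the last \<open>l\<close> columns of \<open>E P\<^sup>T\<close> by unit vectors gives a matrix whose determinant is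
  the minor of \<open>E\<close>, while the product becomes block triangular with an identity block and the block
  that carries the minor of \<open>H\<close>. Since \<open>det H = 1\<close>, comparing determinants leaves only the
  sign \<open>det P\<close>.\<close>

lemma complementary_minors:
  assumes anti: "\<And>i j. 1 \<le> i \<Longrightarrow> i \<le> j \<Longrightarrow> j \<le> l \<Longrightarrow> \<mu> j \<le> \<mu> i"
    and le: "\<And>i. 1 \<le> i \<Longrightarrow> i \<le> l \<Longrightarrow> \<mu> i \<le> m"
  shows "det (mat l l (\<lambda>(i, j). H (int (Suc i) - int (\<mu> (Suc i))) (int (Suc j)))) =
    (- 1) ^ (\<Sum>i = 1..l. \<mu> i) *
    det (mat m m (\<lambda>(i, j). E (- int i) (int (card {k \<in> {1..l}. Suc j \<le> \<mu> k}) - int j)))"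
proof -
  define x :: "nat \<Rightarrow> int" where "x p = int p + 1 - int m" for p
  define pos where "pos = boundary_position l m \<mu>"
  let ?N = "m + l"
  let ?P = "boundary_matrix l m \<mu> :: 'a mat"
  define Hm where "Hm = mat ?N ?N (\<lambda>(p, q). H (x p) (x q))"
  define E1 where "E1 = mat m m (\<lambda>(p, t). E (x p) (x (pos t)))"
  define E2 where "E2 = mat l m (\<lambda>(p, t). E (x (p + m)) (x (pos t)))"
  define B where "B = mat m l (\<lambda>(s, q). H (x (pos s)) (x (q + m)))"
  define D where "D = mat l l (\<lambda>(s, q). H (x (pos (s + m))) (x (q + m)))"
  have pos_less: "pos s < ?N" if "s < ?N" for s
    using that by (simp add: pos_def boundary_position_less)
  have pos_inj: "pos s = pos t \<longleftrightarrow> s = t" if "s < ?N" "t < ?N" for s t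
    using boundary_position_inject[of l \<mu> m s t] anti le that by (auto simp: pos_def)
  have carr: "?P \<in> carrier_mat ?N ?N" "Hm \<in> carrier_mat ?N ?N"
    by (simp_all add: boundary_matrix_def Hm_def)
  have PH: "?P * Hm = mat ?N ?N (\<lambda>(s, q). H (x (pos s)) (x q))"
  proof (rule eq_matI)
    fix s q assume "s < dim_row (mat ?N ?N (\<lambda>(s, q). H (x (pos s)) (x q)))"
      "q < dim_col (mat ?N ?N (\<lambda>(s, q). H (x (pos s)) (x q)))"
    then have sq: "s < ?N" "q < ?N" by simp_all
    then have "(?P * Hm) $$ (s, q) = (\<Sum>p = 0..<?N. (if p = pos s then 1 else 0) * H (x p) (x q))"
      by (simp add: boundary_matrix_def Hm_def scalar_prod_def pos_def)
    also have "\<dots> = (\<Sum>p = 0..<?N. if p = pos s then H (x p) (x q) else 0)"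
      by (rule sum.cong) auto
    also have "\<dots> = H (x (pos s)) (x q)"
      using pos_less[OF sq(1)] by simp
    finally show "(?P * Hm) $$ (s, q) = mat ?N ?N (\<lambda>(s, q). H (x (pos s)) (x q)) $$ (s, q)"
      using sq by simp
  qed (simp_all add: boundary_matrix_def Hm_def)
  have det_Hm: "det Hm = 1"
  proof -
    have "upper_triangular Hm"
      by (rule upper_triangularI) (auto simp: Hm_def x_def H_below)
    then have "det Hm = prod_list (diag_mat Hm)"
      by (rule det_upper_triangular[OF _ carr(2)])
    also have "\<dots> = 1"
      by (simp add: prod_list_diag_prod Hm_def H_diag)
    finally show ?thesis .
  qed
  have "?P * Hm * four_block_mat E1 (0\<^sub>m m l) E2 (1\<^sub>m l) = four_block_mat (1\<^sub>m m) B (0\<^sub>m l m) D"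
    (is "?L = ?R")
  proof (rule eq_matI)
    fix s t assume "s < dim_row ?R" "t < dim_col ?R"
    then have st: "s < ?N" "t < ?N" by (simp_all add: D_def)
    have L: "?L $$ (s, t) = (\<Sum>p = 0..<?N. H (x (pos s)) (x p) *
        four_block_mat E1 (0\<^sub>m m l) E2 (1\<^sub>m l) $$ (p, t))"
      unfolding PH using st by (simp add: scalar_prod_def E1_def)
    show "?L $$ (s, t) = ?R $$ (s, t)"
    proof (cases "t < m")
      case True
      have "?L $$ (s, t) = (\<Sum>p = 0..<?N. H (x (pos s)) (x p) * E (x p) (x (pos t)))"
        unfolding L by (rule sum.cong) (use True in \<open>auto simp: E1_def E2_def\<close>)
      also have "\<dots> = (\<Sum>z = 1 - int m..int l. H (x (pos s)) z * E z (x (pos t)))"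
        by (rule sum.reindex_bij_witness[where j = x and i = "\<lambda>z. nat (z - 1 + int m)"])
          (auto simp: x_def)
      also have "\<dots> = (if x (pos s) = x (pos t) then 1 else 0)"
        using pos_less[OF st(1)] pos_less[OF st(2)] by (intro H_E_window) (auto simp: x_def)
      also have "\<dots> = (if s = t then 1 else 0)"
        using pos_inj[OF st] by (simp add: x_def)
      also have "\<dots> = ?R $$ (s, t)"
        using st True by (auto simp: D_def)
      finally show ?thesis .
    next
      case False
      have "?L $$ (s, t) = (\<Sum>p = 0..<?N. if p = t then H (x (pos s)) (x p) else 0)"
        unfolding L by (rule sum.cong) (use st False in \<open>auto simp: E1_def E2_def\<close>)
      also have "\<dots> = H (x (pos s)) (x t)"
        using st by simp
      also have "\<dots> = ?R $$ (s, t)"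
        using st False by (auto simp: B_def D_def)
      finally show ?thesis .
    qed
  qed (simp_all add: boundary_matrix_def E1_def D_def)
  then have "det ?L = det ?R" by simp
  moreover have "det ?L = det ?P * det Hm * det E1"
  proof -
    have E1: "E1 \<in> carrier_mat m m" and E2: "E2 \<in> carrier_mat l m"
      by (simp_all add: E1_def E2_def)
    have "det ?L = det ?P * det Hm * det (four_block_mat E1 (0\<^sub>m m l) E2 (1\<^sub>m l))"
      using carr E1 by (simp add: det_mult[of _ ?N])
    also have "det (four_block_mat E1 (0\<^sub>m m l) E2 (1\<^sub>m l)) = det E1 * det (1\<^sub>m l)"
      by (rule det_four_block_mat_upper_right_zero[OF E1 refl E2]) simp
    finally show ?thesis by simp
  qed
  moreover have "det ?R = det D"
    by (subst det_four_block_mat_lower_left_zero[of _ m _ l]) (simp_all add: B_def D_def)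
  moreover have "det ?P = (- 1) ^ (\<Sum>i = 1..l. \<mu> i)"
    using anti le by (rule det_boundary_matrix)
  moreover have "D = mat l l (\<lambda>(i, j). H (int (Suc i) - int (\<mu> (Suc i))) (int (Suc j)))"
  proof (rule eq_matI)
    fix i j assume ij: "i < dim_row (mat l l (\<lambda>(i, j). H (int (Suc i) - int (\<mu> (Suc i))) (int (Suc j))))"
      "j < dim_col (mat l l (\<lambda>(i, j). H (int (Suc i) - int (\<mu> (Suc i))) (int (Suc j))))"
    then have "x (pos (i + m)) = int (Suc i) - int (\<mu> (Suc i))" "x (j + m) = int (Suc j)"
      using le[of "Suc i"] by (simp_all add: x_def pos_def boundary_position_def of_nat_diff)
    with ij show "D $$ (i, j) =
        mat l l (\<lambda>(i, j). H (int (Suc i) - int (\<mu> (Suc i))) (int (Suc j))) $$ (i, j)"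
      by (simp add: D_def)
  qed (simp_all add: D_def)
  \<comment> \<open>The window lists \<open>1 - j\<close> in increasing order, hence \<open>j\<close> in decreasing order.\<close>
  moreover have "det E1 =
      det (mat m m (\<lambda>(i, j). E (- int i) (int (card {k \<in> {1..l}. Suc j \<le> \<mu> k}) - int j)))"
  proof -
    have "E1 = mat m m (\<lambda>(i, j). E (- int (m - Suc i))
        (int (card {k \<in> {1..l}. Suc (m - Suc j) \<le> \<mu> k}) - int (m - Suc j)))"
      by (rule eq_matI)
        (simp_all add: E1_def x_def pos_def boundary_position_def of_nat_diff Suc_diff_Suc
          algebra_simps)
    with det_reverse_rows_columns[of m "\<lambda>i j. E (- int i)
        (int (card {k \<in> {1..l}. Suc j \<le> \<mu> k}) - int j)"]
    show ?thesis by simp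
  qed
  ultimately show ?thesis by (simp add: det_Hm)
qed

end

text \<open>The entry of the inverse at \<open>(x, x + d)\<close>, obtained by solving the equation for the entry
  \<open>(x, x + d)\<close> of \<open>H E = 1\<close>; it refers to entries of \<open>E\<close> that are closer to the diagonal.\<close>

fun unitriangular_inverse_entry :: "(int \<Rightarrow> int \<Rightarrow> 'a::comm_ring_1) \<Rightarrow> nat \<Rightarrow> int \<Rightarrow> 'a" where
  "unitriangular_inverse_entry H d x =
     (if d = 0 then 1
      else - (\<Sum>k \<in> {1..d}. H x (x + int k) * unitriangular_inverse_entry H (d - k) (x + int k)))"

declare unitriangular_inverse_entry.simps [simp del]

lemma unitriangular_inverse_exists:
  fixes H :: "int \<Rightarrow> int \<Rightarrow> 'a::idom"
  assumes diag: "\<And>x. H x x = 1" and below: "\<And>x y. y < x \<Longrightarrow> H x y = 0"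
  shows "\<exists>E. unitriangular_inverse H E"
proof -
  define E where "E x y = (if y < x then 0 else unitriangular_inverse_entry H (nat (y - x)) x)"
    for x y
  have "(\<Sum>z = x..y. H x z * E z y) = (if x = y then 1 else 0)" if "x \<le> y" for x y
  proof (cases "x = y")
    case True
    then show ?thesis
      by (simp add: diag E_def unitriangular_inverse_entry.simps[of H 0])
  next
    case False
    define d where "d = nat (y - x)"
    have d: "d \<noteq> 0" "y = x + int d" using that False by (simp_all add: d_def)
    have "(\<Sum>z = x..y. H x z * E z y) =
        (\<Sum>k = 0..d. H x (x + int k) * unitriangular_inverse_entry H (d - k) (x + int k))"
      by (rule sum.reindex_bij_witness[where i = "\<lambda>k. x + int k" and j = "\<lambda>z. nat (z - x)"])
        (auto simp: d E_def nat_diff_distrib intro!: arg_cong2[where f = "unitriangular_inverse_entry H"])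
    also have "\<dots> = unitriangular_inverse_entry H d x +
        (\<Sum>k = 1..d. H x (x + int k) * unitriangular_inverse_entry H (d - k) (x + int k))"
      by (simp add: sum.atLeast_Suc_atMost diag)
    also have "\<dots> = 0"
      by (subst unitriangular_inverse_entry.simps) (simp add: d)
    finally show ?thesis using False by simp
  qed
  then have "unitriangular_inverse H E"
    by unfold_locales (simp_all add: diag below E_def)
  then show ?thesis by (rule exI[of _ E])
qed

section \<open>Conjugate diagrams\<close>

lemma young_diagram_antimono:
  assumes "young_diagram \<mu>" "1 \<le> i" "i \<le> j"
  shows "\<mu> j \<le> \<mu> i"
  using assms(3)
proof (induction j rule: dec_induct)
  case (step k)
  then have "\<mu> (Suc k) \<le> \<mu> k"
    using assms unfolding young_diagram_def by simp
  with step show ?case by simp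
qed simp

lemma transposed_eq_card_bounded:
  assumes "young_diagram \<mu>" "1 \<le> j"
  shows "transposed \<mu> j = card {k \<in> {1..num_rows \<mu>}. j \<le> \<mu> k}"
proof -
  have "k \<le> num_rows \<mu>" if "j \<le> \<mu> k" for k
    using young_diagram_zero[OF assms(1), of k] that assms(2) by (cases "k \<le> num_rows \<mu>") auto
  then show ?thesis
    unfolding transposed_def using assms(2) by (intro arg_cong[where f = card]) auto
qed

lemma row_le_num_rows_transposed:
  assumes "young_diagram \<mu>" "1 \<le> i"
  shows "\<mu> i \<le> num_rows (transposed \<mu>)"
proof -
  have "transposed \<mu> j = 0" if "\<mu> 1 < j" for j
  proof -
    have none: "\<not> (1 \<le> i \<and> j \<le> \<mu> i)" for i
      using young_diagram_antimono[OF assms(1), of 1 i] that by auto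
    then have "{i. 1 \<le> i \<and> 1 \<le> j \<and> j \<le> \<mu> i} = {}" by blast
    then show ?thesis unfolding transposed_def by (simp only: card.empty)
  qed
  then have "{j. 1 \<le> j \<and> transposed \<mu> j \<noteq> 0} \<subseteq> {..\<mu> 1}"
    by (metis (mono_tags, lifting) CollectD atMost_iff not_le subsetI)
  then have fin: "finite {j. 1 \<le> j \<and> transposed \<mu> j \<noteq> 0}"
    by (rule finite_subset) simp
  have "transposed \<mu> j \<noteq> 0" if j: "1 \<le> j" "j \<le> \<mu> i" for j
  proof -
    have "i \<le> num_rows \<mu>"
      using young_diagram_zero[OF assms(1), of i] j by (cases "i \<le> num_rows \<mu>") auto
    then have "i \<in> {k \<in> {1..num_rows \<mu>}. j \<le> \<mu> k}"
      using j assms(2) by simp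
    then show ?thesis
      unfolding transposed_eq_card_bounded[OF assms(1) j(1)] by (auto simp: card_eq_0_iff)
  qed
  then have "{1..\<mu> i} \<subseteq> {j. 1 \<le> j \<and> transposed \<mu> j \<noteq> 0}" by auto
  from card_mono[OF fin this] show ?thesis
    by (simp add: num_rows_def)
qed

text \<open>Both sides count the cells of the first \<open>l\<close> rows.\<close>

lemma sum_column_lengths:
  fixes \<mu> :: "nat \<Rightarrow> nat"
  assumes "\<And>k. 1 \<le> k \<Longrightarrow> k \<le> l \<Longrightarrow> \<mu> k \<le> n"
  shows "(\<Sum>j<n. card {k \<in> {1..l}. Suc j \<le> \<mu> k}) = (\<Sum>k = 1..l. \<mu> k)"
proof -
  have "(\<Sum>j<n. card {k \<in> {1..l}. Suc j \<le> \<mu> k}) =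
      (\<Sum>j<n. \<Sum>k = 1..l. if Suc j \<le> \<mu> k then 1 else 0)"
    by (intro sum.cong refl) (simp only: card_eq_sum sum.inter_filter finite_atLeastAtMost)
  also have "\<dots> = (\<Sum>k = 1..l. \<Sum>j<n. if Suc j \<le> \<mu> k then 1 else 0)"
    by (rule sum.swap)
  also have "\<dots> = (\<Sum>k = 1..l. \<mu> k)"
  proof (rule sum.cong)
    fix k assume "k \<in> {1..l}"
    then have "{j \<in> {..<n}. Suc j \<le> \<mu> k} = {..<\<mu> k}"
      using assms[of k] by auto
    then show "(\<Sum>j<n. if Suc j \<le> \<mu> k then 1 else 0) = \<mu> k"
      by (simp flip: sum.inter_filter)
  qed simp
  finally show ?thesis .
qed

section \<open>Multiparameter Schur functions as minors\<close>

definition complete_array :: "(int \<Rightarrow> complex) \<Rightarrow> int \<Rightarrow> int \<Rightarrow> symfun" where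
  "complete_array a x y = mp_complete (y - x) (tau (1 - y) a)"

lemma tau_tau: "tau r (tau s a) = tau (r + s) a"
  by (simp add: tau_def add.assoc)

text \<open>Applying \<open>\<tau>\<^sup>-\<^sup>x\<close> to the parameters translates the array by \<open>x\<close> along the diagonal. The
  general \<open>x\<close> is what relates the shifted elementary functions to all entries of the inverse.\<close>

lemma jacobi_trudi_eq_minor:
  "jacobi_trudi l \<mu> (tau (- x) a) = det (mat l l (\<lambda>(i, j).
     complete_array a (x + (int (Suc i) - int (\<mu> (Suc i)))) (x + int (Suc j))))"
  unfolding jacobi_trudi_def det_order_def complete_array_def
  by (intro arg_cong[where f = det] eq_matI) (auto simp: tau_tau algebra_simps)

lemma num_rows_column: "num_rows (column k) = k"
proof -
  have "{i. 1 \<le> i \<and> column k i \<noteq> 0} = {1..k}"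
    by (auto simp: column_def)
  then show ?thesis by (simp add: num_rows_def)
qed

text \<open>The diagram with one column of length \<open>k\<close> has \<open>m = 1\<close>, so its complementary minor is the
  single entry \<open>(0, k)\<close> of the inverse, here of the array translated by \<open>x\<close>.\<close>

lemma mp_elementary_eq_inverse_entry:
  assumes "unitriangular_inverse (complete_array a) E" "x \<le> y"
  shows "E x y = (- 1) ^ nat (y - x) * mp_elementary (y - x) (tau (- x) a)"
proof -
  interpret unitriangular_inverse "complete_array a" E by fact
  show ?thesis
  proof (cases "x = y")
    case True
    with H_E[of x x] show ?thesis
      by (simp add: H_diag mp_elementary_def)
  next
    case False
    define k where "k = nat (y - x)"
    have k: "0 < k" "y = x + int k" using assms(2) False by (simp_all add: k_def)
    interpret shifted: unitriangular_inverse
      "\<lambda>u v. complete_array a (x + u) (x + v)" "\<lambda>u v. E (x + u) (x + v)"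
    proof
      fix u v :: int assume "u \<le> v"
      have "(\<Sum>z = u..v. complete_array a (x + u) (x + z) * E (x + z) (x + v)) =
          (\<Sum>z = x + u..x + v. complete_array a (x + u) z * E z (x + v))"
        by (rule sum.reindex_bij_witness[where i = "\<lambda>z. z - x" and j = "\<lambda>z. x + z"]) auto
      with \<open>u \<le> v\<close> show "(\<Sum>z = u..v. complete_array a (x + u) (x + z) * E (x + z) (x + v)) =
          (if u = v then 1 else 0)"
        by (simp add: H_E)
    qed (simp_all add: H_diag H_below E_below)
    have ones: "{i \<in> {1..k}. Suc 0 \<le> column k i} = {1..k}"
      by (auto simp: column_def)
    have "mp_elementary (y - x) (tau (- x) a) = jacobi_trudi k (column k) (tau (- x) a)"
      using k by (simp add: mp_elementary_def mp_schur_def num_rows_column)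
    also have "\<dots> = (- 1) ^ (\<Sum>i = 1..k. column k i) *
        det (mat 1 1 (\<lambda>(i, j). E (x + - int i)
          (x + (int (card {i \<in> {1..k}. Suc j \<le> column k i}) - int j))))"
      unfolding jacobi_trudi_eq_minor
      by (rule shifted.complementary_minors) (auto simp: column_def)
    also have "\<dots> = (- 1) ^ k * E x y"
      using k ones by (simp add: det_single column_def)
    finally show ?thesis
      using k by (simp add: power_mult_distrib[symmetric] mult.assoc[symmetric])
  qed
qed

theorem corollary4p9:
  fixes a :: "int \<Rightarrow> complex" and \<mu> :: "nat \<Rightarrow> nat" and n :: nat
  assumes "young_diagram \<mu>"
    and "num_rows (transposed \<mu>) \<le> n"
  shows "mp_schur \<mu> a =
    det_order n (\<lambda>i j. mp_elementary (int (transposed \<mu> i) - int i + int j) (tau (int j - 1) a))"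
proof -
  define l where "l = num_rows \<mu>"
  define c where "c j = transposed \<mu> (Suc j)" for j
  define e where "e i j = mp_elementary (int (c j) - int j + int i) (tau (int i) a)" for i j
  have c: "card {k \<in> {1..l}. Suc j \<le> \<mu> k} = c j" for j
    using transposed_eq_card_bounded[OF assms(1), of "Suc j"] by (simp add: c_def l_def)
  have rows: "\<mu> i \<le> n" if "1 \<le> i" for i
    using row_le_num_rows_transposed[OF assms(1) that] assms(2) by simp
  have "\<exists>E. unitriangular_inverse (complete_array a) E"
  proof (rule unitriangular_inverse_exists)
    show "complete_array a x x = 1" for x
      by (simp add: complete_array_def mp_complete_0)
    show "complete_array a x y = 0" if "y < x" for x y
      using that by (simp add: complete_array_def mp_complete_def)
  qed
  then obtain E where "unitriangular_inverse (complete_array a) E"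
    by (rule exE)
  then interpret unitriangular_inverse "complete_array a" E .
  \<comment> \<open>The sign \<open>(-1)\<^bsup>y-x\<^esup>\<close> splits into a row factor and a column factor. Below the
    diagonal, where \<open>y - x\<close> is negative, both sides vanish.\<close>
  have entry: "E (- int i) (int (c j) - int j) = (- 1) ^ i * (- 1) ^ (c j + j) * e i j" for i j
  proof (cases "- int i \<le> int (c j) - int j")
    case True
    define d where "d = nat (int (c j) - int j + int i)"
    have "even d \<longleftrightarrow> even (i + (c j + j))"
    proof -
      have "i + c j = d + j" using True by (simp add: d_def)
      then show ?thesis by presburger
    qed
    then have "(- 1 :: symfun) ^ d = (- 1) ^ (i + (c j + j))"
      by (simp add: minus_one_power_iff)
    with mp_elementary_eq_inverse_entry[OF unitriangular_inverse_axioms True]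
    show ?thesis by (simp add: d_def e_def power_add)
  next
    case False
    then show ?thesis by (simp add: E_below e_def mp_elementary_def)
  qed
  have "mp_schur \<mu> a = jacobi_trudi l \<mu> (tau (- 0) a)"
    by (simp add: mp_schur_def l_def tau_def)
  also have "\<dots> = det (mat l l (\<lambda>(i, j).
      complete_array a (int (Suc i) - int (\<mu> (Suc i))) (int (Suc j))))"
    unfolding jacobi_trudi_eq_minor by simp
  also have "\<dots> = (- 1) ^ (\<Sum>i = 1..l. \<mu> i) *
      det (mat n n (\<lambda>(i, j). E (- int i) (int (c j) - int j)))"
    unfolding c[symmetric]
    by (rule complementary_minors) (use young_diagram_antimono[OF assms(1)] rows in auto)
  also have "\<dots> = (- 1) ^ (\<Sum>i = 1..l. \<mu> i) *
      ((\<Prod>i<n. (- 1) ^ i) * (\<Prod>j<n. (- 1) ^ (c j + j)) * det (mat n n (\<lambda>(i, j). e i j)))"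
    unfolding entry by (simp only: det_rescale_rows_columns)
  also have "\<dots> = det (mat n n (\<lambda>(i, j). e i j))"
  proof -
    have "(\<Sum>i = 1..l. \<mu> i) = (\<Sum>j<n. c j)"
      using sum_column_lengths[of l \<mu> n] rows unfolding c by simp
    moreover have "(\<Prod>i<n. (- 1 :: symfun) ^ i) * (\<Prod>j<n. (- 1) ^ (c j + j)) =
        (- 1) ^ (\<Sum>j<n. c j)"
      unfolding power_sum prod.distrib[symmetric]
      by (rule prod.cong) (simp_all add: minus_one_power_iff)
    ultimately have "(- 1 :: symfun) ^ (\<Sum>i = 1..l. \<mu> i) *
        ((\<Prod>i<n. (- 1) ^ i) * (\<Prod>j<n. (- 1) ^ (c j + j))) = 1"
      by (simp add: minus_one_power_iff)
    then show ?thesis by (simp add: mult.assoc[symmetric])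
  qed
  also have "\<dots> = det (mat n n (\<lambda>(i, j). e j i))"
    by (rule det_transpose_entries)
  also have "\<dots> = det_order n
      (\<lambda>i j. mp_elementary (int (transposed \<mu> i) - int i + int j) (tau (int j - 1) a))"
    unfolding det_order_def by (simp add: e_def c_def algebra_simps)
  finally show ?thesis .
qed

end
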